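(* Let $R\in\mathbb{R}^{n\times n}$ be invertible. The sign pairing $[\![x,y]\!]_{1,R}:=\|y\|_{1,R}\,\operatorname{sign}(Ry)^\top Rx$ on $\mathbb{R}^n$ is a Lumer pairing compatible with the weighted $\ell_1$ norm $\|\cdot\|_{1,R}$.
   Context: $\|x\|_{1,R}=\|Rx\|_1$. $\operatorname{sign}:\mathbb{R}^n\to\{-1,0,1\}^n$ is the entrywise sign, with $\operatorname{sign}(0)=0$. A Lumer pairing on $\mathbb{R}^n$ is a map $[\cdot,\cdot]:\mathbb{R}^n\times\mathbb{R}^n\to\mathbb{R}$ such that: (1) $[x_1+x_2,y]=[x_1,y]+[x_2,y]$ for all $x_1,x_2,y$; (2) $[\alpha x,y]=[x,\alpha y]=\alpha[x,y]$ for all $x,y$ and $\alpha\in\mathbb{R}$; (3) $[x,x]>0$ for all $x\ne0_n$; (4) $|[x,y]|\le[x,x]^{1/2}[y,y]^{1/2}$ for all $x,y$. It is compatible with a norm $\|\cdot\|$ if $\|x\|=[x,x]^{1/2}$ for all $x$. *)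

theory Defs
  imports "HOL-Analysis.Analysis"
begin

definition l1_norm :: "real ^ 'n \<Rightarrow> real" where
  "l1_norm x = (\<Sum>i\<in>UNIV. \<bar>x $ i\<bar>)"

definition weighted_l1_norm :: "real ^ 'n ^ 'n \<Rightarrow> real ^ 'n \<Rightarrow> real" where
  "weighted_l1_norm R x = l1_norm (R *v x)"

text \<open>The library's \<open>sgn\<close> on vectors is the normalisation \<open>x /\<^sub>R norm x\<close>,
  so the entrywise sign needs a definition of its own.\<close>

definition sign_vec :: "real ^ 'n \<Rightarrow> real ^ 'n" where
  "sign_vec x = (\<chi> i. sgn (x $ i))"

definition lumer_pairing :: "(real ^ 'n \<Rightarrow> real ^ 'n \<Rightarrow> real) \<Rightarrow> bool" where
  "lumer_pairing P \<longleftrightarrow>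
     (\<forall>x1 x2 y. P (x1 + x2) y = P x1 y + P x2 y) \<and>
     (\<forall>\<alpha> x y. P (\<alpha> *\<^sub>R x) y = \<alpha> * P x y \<and> P x (\<alpha> *\<^sub>R y) = \<alpha> * P x y) \<and>
     (\<forall>x. x \<noteq> 0 \<longrightarrow> P x x > 0) \<and>
     (\<forall>x y. \<bar>P x y\<bar> \<le> sqrt (P x x) * sqrt (P y y))"

definition compatible_with ::
  "(real ^ 'n \<Rightarrow> real ^ 'n \<Rightarrow> real) \<Rightarrow> (real ^ 'n \<Rightarrow> real) \<Rightarrow> bool" where
  "compatible_with P N \<longleftrightarrow> (\<forall>x. N x = sqrt (P x x))"

definition sign_pairing :: "real ^ 'n ^ 'n \<Rightarrow> real ^ 'n \<Rightarrow> real ^ 'n \<Rightarrow> real" where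
  "sign_pairing R x y = weighted_l1_norm R y * (sign_vec (R *v y) \<bullet> (R *v x))"

text \<open>For invertible \<open>R\<close> the weighted \<open>\<ell>\<^sub>1\<close> norm is a norm.\<close>

lemma weighted_l1_norm_nonneg: "0 \<le> weighted_l1_norm R x"
  by (simp add: weighted_l1_norm_def l1_norm_def sum_nonneg)

lemma weighted_l1_norm_eq_0_iff:
  assumes "invertible R"
  shows "weighted_l1_norm R x = 0 \<longleftrightarrow> x = 0"
proof -
  have "weighted_l1_norm R x = 0 \<longleftrightarrow> R *v x = 0"
    by (simp add: weighted_l1_norm_def l1_norm_def sum_nonneg_eq_0_iff vec_eq_iff)
  also have "\<dots> \<longleftrightarrow> x = 0"
  proof
    assume "R *v x = 0"
    moreover obtain S where "S ** R = mat 1"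
      using assms by (auto simp: invertible_def)
    ultimately show "x = 0"
      by (metis matrix_vector_mul_assoc matrix_vector_mul_lid matrix_vector_mult_0_right)
  qed simp
  finally show ?thesis .
qed

lemma weighted_l1_norm_scaleR: "weighted_l1_norm R (\<alpha> *\<^sub>R x) = \<bar>\<alpha>\<bar> * weighted_l1_norm R x"
  by (simp add: weighted_l1_norm_def l1_norm_def matrix_vector_mult_scaleR abs_mult sum_distrib_left)

lemma weighted_l1_norm_triangle:
  "weighted_l1_norm R (x + y) \<le> weighted_l1_norm R x + weighted_l1_norm R y"
  by (simp add: weighted_l1_norm_def l1_norm_def matrix_vector_right_distrib
      flip: sum.distrib) (simp add: sum_mono abs_triangle_ineq)

end

theory Submission
  imports Defs
begin

text \<open>The sign vector of \<open>v\<close> is the functional dual to \<open>v\<close> for the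
  \<open>\<ell>\<^sub>1\<close>/\<open>\<ell>\<^sub>\<infinity>\<close> duality: it attains the norm, \<open>sign(v) \<bullet> v = \<parallel>v\<parallel>\<^sub>1\<close>, and its entries are bounded
  by \<open>1\<close>, so that \<open>\<bar>sign(v) \<bullet> w\<bar> \<le> \<parallel>w\<parallel>\<^sub>1\<close> for every \<open>w\<close>. Taking \<open>v = R y\<close>, the first fact says
  that the pairing of \<open>y\<close> with itself is the squared weighted norm of \<open>y\<close>, which yields both
  compatibility and, since \<open>R\<close> is injective, positive definiteness. The second gives the
  Cauchy--Schwarz inequality. Linearity in the first argument is that of the inner product and
  of \<open>R\<close>; homogeneity in the second holds because a factor \<open>\<alpha>\<close> leaves the norm as \<open>\<bar>\<alpha>\<bar>\<close> and the
  sign vector as \<open>sgn \<alpha>\<close>, with product \<open>\<alpha>\<close>.\<close>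

lemma sign_vec_inner_self: "sign_vec v \<bullet> v = l1_norm v"
  by (simp add: sign_vec_def l1_norm_def inner_vec_def abs_sgn mult.commute)

lemma abs_sign_vec_inner_le: "\<bar>sign_vec v \<bullet> w\<bar> \<le> l1_norm w"
proof -
  have "\<bar>sign_vec v \<bullet> w\<bar> \<le> (\<Sum>i\<in>UNIV. \<bar>sgn (v $ i) * w $ i\<bar>)"
    unfolding sign_vec_def inner_vec_def by (simp add: sum_abs)
  also have "\<dots> \<le> l1_norm w"
    unfolding l1_norm_def by (rule sum_mono) (simp add: abs_mult abs_sgn_eq)
  finally show ?thesis .
qed

lemma sign_vec_scaleR: "sign_vec (\<alpha> *\<^sub>R v) = sgn \<alpha> *\<^sub>R sign_vec v"
  by (simp add: sign_vec_def vec_eq_iff sgn_mult)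

lemma sign_pairing_self: "sign_pairing R x x = (weighted_l1_norm R x)\<^sup>2"
  by (simp add: sign_pairing_def sign_vec_inner_self weighted_l1_norm_def power2_eq_square)

lemma sqrt_sign_pairing_self: "sqrt (sign_pairing R x x) = weighted_l1_norm R x"
  by (simp add: sign_pairing_self weighted_l1_norm_nonneg)

lemma sign_pairing_add_left:
  "sign_pairing R (x1 + x2) y = sign_pairing R x1 y + sign_pairing R x2 y"
  by (simp add: sign_pairing_def matrix_vector_right_distrib inner_add_right distrib_left)

lemma sign_pairing_scaleR_left: "sign_pairing R (\<alpha> *\<^sub>R x) y = \<alpha> * sign_pairing R x y"
  by (simp add: sign_pairing_def matrix_vector_mult_scaleR)

lemma sign_pairing_scaleR_right: "sign_pairing R x (\<alpha> *\<^sub>R y) = \<alpha> * sign_pairing R x y"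
proof -
  have "sign_pairing R x (\<alpha> *\<^sub>R y) = (\<bar>\<alpha>\<bar> * sgn \<alpha>) * sign_pairing R x y"
    by (simp add: sign_pairing_def weighted_l1_norm_scaleR matrix_vector_mult_scaleR
        sign_vec_scaleR)
  then show ?thesis
    by (simp add: abs_mult_sgn)
qed

lemma sign_pairing_Cauchy_Schwarz:
  "\<bar>sign_pairing R x y\<bar> \<le> sqrt (sign_pairing R x x) * sqrt (sign_pairing R y y)"
proof -
  have "\<bar>sign_pairing R x y\<bar> = weighted_l1_norm R y * \<bar>sign_vec (R *v y) \<bullet> (R *v x)\<bar>"
    by (simp add: sign_pairing_def abs_mult weighted_l1_norm_nonneg)
  also have "\<dots> \<le> weighted_l1_norm R y * weighted_l1_norm R x"
    unfolding weighted_l1_norm_def [of R x]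
    by (rule mult_left_mono [OF abs_sign_vec_inner_le weighted_l1_norm_nonneg])
  finally show ?thesis
    by (simp add: sqrt_sign_pairing_self mult.commute)
qed

theorem lemma20:
  fixes R :: "real ^ 'n ^ 'n"
  assumes "invertible R"
  shows "lumer_pairing (sign_pairing R) \<and>
         compatible_with (sign_pairing R) (weighted_l1_norm R)"
proof
  have "sign_pairing R x x > 0" if "x \<noteq> 0" for x
    using that by (simp add: sign_pairing_self weighted_l1_norm_eq_0_iff [OF assms])
  then show "lumer_pairing (sign_pairing R)"
    by (simp add: lumer_pairing_def sign_pairing_add_left sign_pairing_scaleR_left
        sign_pairing_scaleR_right sign_pairing_Cauchy_Schwarz)
  show "compatible_with (sign_pairing R) (weighted_l1_norm R)"
    by (simp add: compatible_with_def sqrt_sign_pairing_self)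
qed

end
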